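(* Let $M \geq 2$ be an integer and let $N = 4M-5$. Then there is a nonempty open set $U \subset \mathbb{C}^{N\times M}$ such that every $A \in U$ is not injective for phase retrieval. In particular, if $A \in \mathbb{C}^{N\times M}$ is a random matrix whose entries are i.i.d. standard complex Gaussian random variables, and $p_M$ denotes the probability that $A$ is injective for phase retrieval, then $p_M < 1$.
   Context: For $x, y \in \mathbb{C}^M$, write $x \sim y$ if there is $z \in \mathbb{C}$ with $|z|=1$ and $x = zy$; let $\mathbb{C}^M (\operatorname{mod} \mathbb{T})$ denote the set of equivalence classes. For $A \in \mathbb{C}^{N\times M}$, let $\Phi_A : \mathbb{C}^M (\operatorname{mod} \mathbb{T}) \to \mathbb{R}^N$ be the well-defined map sending the class of $x$ to $|Ax|$, where $|\cdot|$ denotes the entrywise modulus. The matrix $A$ is called injective for phase retrieval if $\Phi_A$ is injective. The space $\mathbb{C}^{N\times M}$ carries its usual Euclidean topology. A standard complex Gaussian random variable has the law of $a + ib$ where $a, b \sim \mathcal{N}(0,\tfrac12)$ are independent real Gaussians. *)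

theory Defs
  imports "HOL-Analysis.Analysis" "HOL-Probability.Probability"
begin

definition phase_equiv :: "complex ^ 'm \<Rightarrow> complex ^ 'm \<Rightarrow> bool" where
  "phase_equiv x y \<longleftrightarrow> (\<exists>z. cmod z = 1 \<and> x = z *s y)"

lemma equivp_phase_equiv: "equivp (phase_equiv :: complex ^ 'm \<Rightarrow> complex ^ 'm \<Rightarrow> bool)"
proof (rule equivpI)
  show "reflp (phase_equiv :: complex ^ 'm \<Rightarrow> _)"
    unfolding phase_equiv_def by (intro reflpI exI[of _ 1]) simp
  show "symp (phase_equiv :: complex ^ 'm \<Rightarrow> _)"
  proof (rule sympI)
    fix x y :: "complex ^ 'm"
    assume "phase_equiv x y"
    then obtain z where z: "cmod z = 1" "x = z *s y" by (auto simp: phase_equiv_def)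
    from z(1) have "z \<noteq> 0" by auto
    with z(2) have "y = inverse z *s x" by simp
    with z show "phase_equiv y x"
      unfolding phase_equiv_def by (intro exI[of _ "inverse z"]) (simp add: norm_inverse)
  qed
  show "transp (phase_equiv :: complex ^ 'm \<Rightarrow> _)"
  proof (rule transpI)
    fix x y w :: "complex ^ 'm"
    assume "phase_equiv x y" "phase_equiv y w"
    then obtain z z' where "cmod z = 1" "x = z *s y" "cmod z' = 1" "y = z' *s w"
      by (auto simp: phase_equiv_def)
    then show "phase_equiv x w"
      unfolding phase_equiv_def
      by (intro exI[of _ "z * z'"]) (simp add: norm_mult)
  qed
qed

text \<open>The quotient of \<open>complex ^ 'm\<close> by the unimodular scalars.\<close>

quotient_type (overloaded) 'm phase_class = "complex ^ ('m::finite)" / phase_equiv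
  by (rule equivp_phase_equiv)

lift_definition Phi :: "complex ^ 'm ^ 'n \<Rightarrow> 'm::finite phase_class \<Rightarrow> real ^ 'n"
  is "\<lambda>A x. \<chi> i. cmod ((A *v x) $ i)"
  unfolding phase_equiv_def by (clarsimp simp: vector_scalar_commute norm_mult)

definition injective_for_phase_retrieval :: "complex ^ 'm ^ 'n \<Rightarrow> bool" where
  "injective_for_phase_retrieval A \<longleftrightarrow> inj (Phi A)"

text \<open>The second argument of \<^const>\<open>normal_density\<close> is the standard deviation, so the real and
  the imaginary part each have variance \<open>1/2\<close>.\<close>

definition std_complex_gaussian :: "complex measure" where
  "std_complex_gaussian =
     distr (density lborel (normal_density 0 (sqrt (1/2))) \<Otimes>\<^sub>M
            density lborel (normal_density 0 (sqrt (1/2))))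
       borel (\<lambda>(a, b). Complex a b)"

definition gaussian_random_matrix :: "'w measure \<Rightarrow> ('w \<Rightarrow> complex ^ 'm ^ 'n) \<Rightarrow> bool" where
  "gaussian_random_matrix P A \<longleftrightarrow>
     prob_space P \<and>
     prob_space.indep_vars P (\<lambda>_. borel) (\<lambda>(i, j) \<omega>. A \<omega> $ i $ j) UNIV \<and>
     (\<forall>i j. distr P borel (\<lambda>\<omega>. A \<omega> $ i $ j) = std_complex_gaussian)"

definition injectivity_probability :: "'w measure \<Rightarrow> ('w \<Rightarrow> complex ^ 'm ^ 'n) \<Rightarrow> real" where
  "injectivity_probability P A =
     measure P {\<omega> \<in> space P. injective_for_phase_retrieval (A \<omega>)}"

text \<open>\<^const>\<open>measure\<close> is \<open>0\<close> on non-measurable sets. The remaining lemmas show that the event in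
  \<open>injectivity_probability\<close> is measurable, so that this convention plays no role.\<close>

lemma injective_for_phase_retrieval_iff:
  "injective_for_phase_retrieval A \<longleftrightarrow>
     (\<forall>x y. (\<forall>i. cmod ((A *v x) $ i) = cmod ((A *v y) $ i)) \<longrightarrow> phase_equiv x y)"
proof -
  have "inj (Phi A) \<longleftrightarrow> (\<forall>X Y. Phi A X = Phi A Y \<longrightarrow> X = Y)"
    by (auto simp: inj_def)
  also have "\<dots> \<longleftrightarrow> (\<forall>x y. (\<chi> i. cmod ((A *v x) $ i)) = (\<chi> i. cmod ((A *v y) $ i))
      \<longrightarrow> phase_equiv x y)"
    by transfer auto
  finally show ?thesis
    by (simp add: injective_for_phase_retrieval_def vec_eq_iff)
qed

lemma closed_phase_equiv: "closed {p :: (complex ^ 'm) \<times> (complex ^ 'm). phase_equiv (fst p) (snd p)}"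
proof -
  let ?T = "{q :: complex \<times> (complex ^ 'm) \<times> (complex ^ 'm).
    fst (snd q) = (\<chi> i. fst q * snd (snd q) $ i)}"
  have "closed ?T"
    by (intro closed_Collect_eq continuous_intros)
  then have "closed {p. \<exists>z. z \<in> sphere 0 1 \<and> (z, p) \<in> ?T}"
    by (intro closed_compact_projection compact_sphere)
  also have "{p. \<exists>z. z \<in> sphere 0 1 \<and> (z, p) \<in> ?T} = {p. phase_equiv (fst p) (snd p)}"
    by (auto simp: phase_equiv_def vector_scalar_mult_def)
  finally show ?thesis .
qed

lemma borel_injective_for_phase_retrieval:
  "{A :: complex ^ 'm ^ 'n. injective_for_phase_retrieval A} \<in> sets borel"
proof -
  let ?T = "{q :: ((complex ^ 'm) \<times> (complex ^ 'm)) \<times> (complex ^ 'm ^ 'n).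
     \<forall>i. cmod (\<Sum>j\<in>UNIV. snd q $ i $ j * fst (fst q) $ j) =
         cmod (\<Sum>j\<in>UNIV. snd q $ i $ j * snd (fst q) $ j)}"
  let ?W = "- {p :: (complex ^ 'm) \<times> (complex ^ 'm). phase_equiv (fst p) (snd p)}"
  have "open ?W"
    using closed_phase_equiv by (simp add: open_closed)
  then obtain K :: "nat \<Rightarrow> ((complex ^ 'm) \<times> (complex ^ 'm)) set"
    where K: "\<And>n. compact (K n)" "\<Union>(range K) = ?W"
    by (rule open_Union_compact_subsets) blast
  have "closed ?T"
    by (intro closed_Collect_all closed_Collect_eq continuous_intros)
  then have "closed {A. \<exists>p. p \<in> K n \<and> (p, A) \<in> ?T}" for n
    using K(1) by (intro closed_compact_projection)
  then have "(\<Union>n. {A. \<exists>p. p \<in> K n \<and> (p, A) \<in> ?T}) \<in> sets borel"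
    by (intro sets.countable_UN image_subsetI borel_closed)
  also have "(\<Union>n. {A. \<exists>p. p \<in> K n \<and> (p, A) \<in> ?T}) =
      {A. \<exists>p \<in> \<Union>(range K). (p, A) \<in> ?T}"
    by (simp only: set_eq_iff UN_iff mem_Collect_eq) blast
  also have "\<dots> = - {A. injective_for_phase_retrieval A}"
    unfolding K(2) set_eq_iff
    by (simp add: injective_for_phase_retrieval_iff matrix_vector_mult_def
        Bex_def split_paired_Ex conj_commute)
  finally have "- (- {A :: complex ^ 'm ^ 'n. injective_for_phase_retrieval A}) \<in> sets borel"
    by (rule borel_comp)
  then show ?thesis
    by (simp only: double_complement)
qed

lemma gaussian_random_matrix_measurable:
  fixes A :: "'w \<Rightarrow> complex ^ 'm ^ 'n"
  assumes "gaussian_random_matrix P A"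
  shows "A \<in> borel_measurable P"
proof -
  interpret prob_space P using assms by (simp add: gaussian_random_matrix_def)
  have entry: "(\<lambda>\<omega>. A \<omega> $ i $ j) \<in> borel_measurable P" for i j
    using assms unfolding gaussian_random_matrix_def indep_vars_def by auto
  have "(\<lambda>\<omega>. A \<omega> \<bullet> b) \<in> borel_measurable P" if b: "b \<in> Basis" for b
  proof -
    from b obtain i j c where "b = axis i (axis j c)"
      by (auto simp: Basis_vec_def)
    then have "(\<lambda>\<omega>. A \<omega> \<bullet> b) = (\<lambda>\<omega>. A \<omega> $ i $ j \<bullet> c)"
      by (simp add: inner_axis)
    with entry show ?thesis by simp
  qed
  then show ?thesis
    using borel_measurable_euclidean_space by blast
qed

lemma injectivity_event_measurable:
  assumes "gaussian_random_matrix P A"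
  shows "{\<omega> \<in> space P. injective_for_phase_retrieval (A \<omega>)} \<in> sets P"
  using measurable_sets[OF gaussian_random_matrix_measurable[OF assms]
      borel_injective_for_phase_retrieval]
  by (simp add: vimage_def Int_def conj_commute)

end

theory Submission
  imports Defs
begin

text \<open>
  With \<open>x = u + v\<close> and \<open>y = u - v\<close>, the equations \<open>|Ax| = |Ay|\<close> say that the real numbers
  \<open>Re ((Au)\<^sub>i cnj ((Av)\<^sub>i))\<close> vanish. If they vanish at some \<open>(A, u, v)\<close> with \<open>x\<close>, \<open>y\<close> inequivalent and
  their derivative in \<open>(u, v)\<close> is onto, then an open mapping argument yields such a solution
  for every matrix near \<open>A\<close>.

  Such an \<open>A\<close> exists for \<open>u = e\<^sub>k\<close>, \<open>v = e\<^sub>l\<close>: consider all rows \<open>a\<close> with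
  \<open>Re (a\<^sub>k cnj (a\<^sub>l)) = 0\<close>. A vector orthogonal to the gradients of all the corresponding
  equations lies in an explicit space of real dimension 5 (four dimensions come from
  reparametrising the form \<open>u v* + v u*\<close>, one from scaling it), so that \<open>4M - 5\<close> of these
  gradients are linearly independent.
\<close>

section \<open>Polarisation: equal moduli as real orthogonality\<close>

lemma norm_add_eq_norm_diff_iff:
  fixes a b :: "'a::real_inner"
  shows "norm (a + b) = norm (a - b) \<longleftrightarrow> a \<bullet> b = 0"
  by (simp add: norm_eq_sqrt_inner inner_add inner_diff inner_commute)

lemma not_injective_if_orthogonal:
  fixes A :: "complex ^ 'm ^ 'n"
  assumes "\<And>i. (A *v u) $ i \<bullet> (A *v v) $ i = 0"
    and "\<not> phase_equiv (u + v) (u - v)"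
  shows "\<not> injective_for_phase_retrieval A"
proof -
  have "cmod ((A *v (u + v)) $ i) = cmod ((A *v (u - v)) $ i)" for i
    using assms(1)[of i]
    by (simp add: matrix_vector_right_distrib matrix_vector_mult_diff_distrib
        norm_add_eq_norm_diff_iff)
  with assms(2) show ?thesis
    unfolding injective_for_phase_retrieval_iff by blast
qed

section \<open>The moment map and its derivative\<close>

text \<open>Provides the product rule for \<open>A *v x\<close> with both factors varying; in finite
  dimension, real bilinearity already gives boundedness.\<close>

lemma bounded_bilinear_matrix_vector_mult_complex:
  "bounded_bilinear (\<lambda>(A :: complex ^ 'm ^ 'n) x. A *v x)"
  unfolding bilinear_conv_bounded_bilinear[symmetric] bilinear_def linear_iff
  by (simp add: matrix_vector_mult_def vec_eq_iff algebra_simps sum.distrib scaleR_sum_right)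

definition moment :: "complex ^ 'm ^ 'n \<Rightarrow> complex ^ 'm \<Rightarrow> complex ^ 'm \<Rightarrow> real ^ 'n" where
  "moment A u v = (\<chi> i. (A *v u) $ i \<bullet> (A *v v) $ i)"

text \<open>The direction \<open>dA\<close> is included because the open mapping argument moves the
  matrix together with the two vectors.\<close>

definition moment_deriv ::
    "complex ^ 'm ^ 'n \<Rightarrow> complex ^ 'm \<Rightarrow> complex ^ 'm \<Rightarrow>
     (complex ^ 'm ^ 'n) \<times> (complex ^ 'm) \<times> (complex ^ 'm) \<Rightarrow> real ^ 'n" where
  "moment_deriv A u v = (\<lambda>(dA, du, dv). \<chi> i.
     (A *v u) $ i \<bullet> (A *v dv + dA *v v) $ i + (A *v du + dA *v u) $ i \<bullet> (A *v v) $ i)"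

lemma has_derivative_vec_lambda:
  fixes f :: "'a::real_normed_vector \<Rightarrow> real ^ 'n"
  assumes "\<And>i. ((\<lambda>x. f x $ i) has_derivative (\<lambda>x. f' x $ i)) (at a within S)"
  shows "(f has_derivative f') (at a within S)"
  using assms by (subst has_derivative_componentwise_within) (auto simp: Basis_vec_def inner_axis)

lemma moment_has_derivative:
  fixes A :: "complex ^ 'm ^ 'n"
  shows "((\<lambda>p. moment (fst p) (fst (snd p)) (snd (snd p))) has_derivative moment_deriv A u v) (at (A, u, v))"
proof (rule has_derivative_vec_lambda)
  fix i
  \<comment> \<open>Here \<open>g\<close> stands for either projection, so one product rule serves
    both \<open>A *v u\<close> and \<open>A *v v\<close>.\<close>
  have mv: "((\<lambda>p. (fst p *v g (snd p)) $ i) has_derivative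
      (\<lambda>h. (A *v g (snd h) + fst h *v g (u, v)) $ i)) (at (A, u, v))"
    if "bounded_linear g" for g :: "(complex ^ 'm) \<times> (complex ^ 'm) \<Rightarrow> complex ^ 'm"
  proof -
    have "((\<lambda>p. g (snd p)) has_derivative (\<lambda>h. g (snd h))) (at (A, u, v))"
      by (intro bounded_linear.has_derivative[OF that] derivative_intros)
    from bounded_bilinear.FDERIV[OF bounded_bilinear_matrix_vector_mult_complex
        has_derivative_fst[OF has_derivative_ident] this]
    show ?thesis
      by (intro bounded_linear.has_derivative[OF bounded_linear_vec_nth]) simp
  qed
  note u = mv[OF bounded_linear_fst] and v = mv[OF bounded_linear_snd]
  show "((\<lambda>p. moment (fst p) (fst (snd p)) (snd (snd p)) $ i) has_derivative
      (\<lambda>h. moment_deriv A u v h $ i)) (at (A, u, v))"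
    using has_derivative_inner[OF u v]
    by (simp add: moment_def moment_deriv_def case_prod_beta)
qed

lemma continuous_on_moment:
  "continuous_on S (\<lambda>p. moment (fst p) (fst (snd p)) (snd (snd p)))"
  unfolding moment_def matrix_vector_mult_def by (intro continuous_intros)

section \<open>Persistence of a regular solution under perturbation of the matrix\<close>

text \<open>The map \<open>F\<close> carries the matrix along as its first component. Near
  \<open>(A, 0)\<close> every point is then a value of \<open>F\<close> on the inequivalent pairs
  \<open>T\<close>, and the points \<open>(B, 0)\<close> among them give solutions for all matrices
  \<open>B\<close> near \<open>A\<close>.\<close>

lemma open_not_injective_near:
  fixes A :: "complex ^ 'm ^ 'n"
  assumes zero: "moment A u v = 0"
    and surj: "\<And>r. \<exists>du dv. moment_deriv A u v (0, du, dv) = r"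
    and neq: "\<not> phase_equiv (u + v) (u - v)"
  shows "\<exists>U. open U \<and> A \<in> U \<and> (\<forall>B\<in>U. \<not> injective_for_phase_retrieval B)"
proof -
  define F where "F = (\<lambda>p :: (complex ^ 'm ^ 'n) \<times> (complex ^ 'm) \<times> (complex ^ 'm).
    (fst p, moment (fst p) (fst (snd p)) (snd (snd p))))"
  define F' where "F' = (\<lambda>h. (fst h, moment_deriv A u v h))"
  define T where "T = {p :: (complex ^ 'm ^ 'n) \<times> (complex ^ 'm) \<times> (complex ^ 'm).
    \<not> phase_equiv (fst (snd p) + snd (snd p)) (fst (snd p) - snd (snd p))}"
  \<comment> \<open>Inequivalence is an open condition, since \<open>phase_equiv\<close> is a closed
    relation.\<close>
  have "open ((\<lambda>p :: (complex ^ 'm ^ 'n) \<times> (complex ^ 'm) \<times> (complex ^ 'm).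
      (fst (snd p) + snd (snd p), fst (snd p) - snd (snd p))) -`
      (- {p. phase_equiv (fst p) (snd p)}))"
    by (intro open_vimage continuous_intros open_Compl closed_phase_equiv)
  then have "open T"
    by (simp add: T_def vimage_def)
  have F: "(F has_derivative F') (at (A, u, v))"
    unfolding F_def F'_def
    by (intro has_derivative_Pair moment_has_derivative derivative_intros)
  then have lin: "linear F'"
    by (rule has_derivative_linear)
  have "surj F'"
  proof (unfold surj_def, intro allI)
    fix q :: "(complex ^ 'm ^ 'n) \<times> (real ^ 'n)"
    obtain dA r where q: "q = (dA, r)" by fastforce
    \<comment> \<open>\<open>F'\<close> is block triangular: \<open>dA\<close> is prescribed, and
      its effect on the second component is corrected by \<open>du\<close> and
      \<open>dv\<close>.\<close>
    obtain du dv where d: "moment_deriv A u v (0, du, dv) = r - moment_deriv A u v (dA, 0, 0)"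
      using surj by blast
    have "F' (dA, du, dv) = F' (0, du, dv) + F' (dA, 0, 0)"
      by (simp flip: linear_add[OF lin])
    also have "\<dots> = q"
      using d by (simp add: F'_def q)
    finally show "\<exists>h. q = F' h" by metis
  qed
  then obtain g where g: "linear g" "F' \<circ> g = id"
    using linear_surjective_right_inverse lin by blast
  have "F (A, u, v) \<in> interior (F ` T)"
  proof (rule sussmann_open_mapping[OF open_UNIV _ _ F _ g(2)])
    show "continuous_on UNIV F"
      unfolding F_def by (intro continuous_intros continuous_on_moment)
    show "(A, u, v) \<in> interior T"
      using neq \<open>open T\<close> by (simp add: interior_open) (simp add: T_def)
  qed (use g(1) linear_conv_bounded_linear in auto)
  then have A: "(A, 0) \<in> interior (F ` T)"
    using zero by (simp add: F_def)
  show ?thesis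
  proof (intro exI conjI ballI)
    show "open ((\<lambda>B. (B, 0)) -` interior (F ` T))"
      by (intro open_vimage continuous_intros open_interior)
    show "A \<in> (\<lambda>B. (B, 0)) -` interior (F ` T)"
      using A by simp
    fix B assume "B \<in> (\<lambda>B. (B, 0)) -` interior (F ` T)"
    then have "(B, 0) \<in> F ` T"
      using interior_subset by blast
    then obtain x y where "moment B x y = 0" "\<not> phase_equiv (x + y) (x - y)"
      by (auto simp: F_def T_def)
    then show "\<not> injective_for_phase_retrieval B"
      by (intro not_injective_if_orthogonal[of B x y]) (simp_all add: moment_def vec_eq_iff)
  qed
qed

section \<open>Gradients of the row equations and their span\<close>

text \<open>A nonzero \<open>c\<close> orthogonal to the range of \<open>L\<close> would make the
  combination of the \<open>f i\<close> with coefficients \<open>c $ i\<close> orthogonal to every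
  \<open>x\<close>, hence zero.\<close>

lemma independent_family_surj:
  fixes f :: "'n::finite \<Rightarrow> 'a::euclidean_space"
  assumes "inj f" "independent (range f)"
  shows "\<exists>x. \<forall>i. f i \<bullet> x = r i"
proof -
  define L where "L = (\<lambda>x. \<chi> i. f i \<bullet> x)"
  have "linear L"
    unfolding L_def by (rule linearI) (simp_all add: vec_eq_iff inner_add_right)
  have "span (range L) = UNIV"
  proof (rule ccontr)
    assume "span (range L) \<noteq> UNIV"
    then have "span (range L) \<subset> UNIV" by blast
    then obtain c where c: "c \<noteq> 0" "\<And>y. y \<in> span (range L) \<Longrightarrow> orthogonal c y"
      by (rule orthogonal_to_subspace_exists_gen[where T = UNIV, unfolded span_UNIV]) blast
    have "(\<Sum>i\<in>UNIV. c $ i *\<^sub>R f i) \<bullet> x = 0" for x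
      using c(2)[OF span_base, of "L x"]
      by (simp add: orthogonal_def inner_vec_def L_def inner_sum_left)
    then have 0: "(\<Sum>i\<in>UNIV. c $ i *\<^sub>R f i) = 0"
      using inner_eq_zero_iff by blast
    \<comment> \<open>Independence is a property of the set \<open>range f\<close>, so the
      coefficients are reindexed along the injection \<open>f\<close>.\<close>
    have "(\<Sum>y\<in>range f. c $ (inv f y) *\<^sub>R y) = 0"
      using 0 assms(1) by (simp add: sum.reindex)
    then have "c $ (inv f (f i)) = 0" for i
      using independentD[OF assms(2), of "range f" "\<lambda>y. c $ (inv f y)" "f i"] by auto
    with c(1) assms(1) show False
      by (simp add: vec_eq_iff)
  qed
  moreover have "span (range L) = range L"
    using \<open>linear L\<close> by (simp add: linear_subspace_image)
  ultimately obtain x where "L x = (\<chi> i. r i)"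
    by (metis UNIV_I imageE)
  then show ?thesis
    by (auto simp: L_def vec_eq_iff)
qed

text \<open>The gradient, as a function of \<open>(u, v)\<close> at \<open>(axis k 1, axis l 1)\<close>, of the entry of
  \<^const>\<open>moment\<close> that belongs to a row \<open>a\<close>.\<close>

definition row_gradient :: "'m \<Rightarrow> 'm \<Rightarrow> complex ^ 'm \<Rightarrow> (complex ^ 'm) \<times> (complex ^ 'm)" where
  "row_gradient k l a = (\<chi> j. cnj (a $ j) * a $ l, \<chi> j. cnj (a $ j) * a $ k)"

text \<open>The right-hand side is the derivative in direction \<open>(p, q)\<close> of the equation
  of row \<open>a\<close>; conjugation moves a factor across the real inner product.\<close>

lemma row_gradient_inner:
  "row_gradient k l a \<bullet> (p, q) =
    (\<Sum>j\<in>UNIV. a $ j * p $ j) \<bullet> a $ l + a $ k \<bullet> (\<Sum>j\<in>UNIV. a $ j * q $ j)"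
proof -
  have "(cnj x * y) \<bullet> z = (x * z) \<bullet> y" "(cnj x * y) \<bullet> z = y \<bullet> (x * z)" for x y z :: complex
    by (simp_all add: inner_complex_def algebra_simps)
  then show ?thesis
    unfolding row_gradient_def inner_Pair inner_vec_def inner_sum_left inner_sum_right
    by (auto intro!: arg_cong2[of _ _ _ _ "(+)"] sum.cong)
qed

text \<open>Test rows supported on at most two coordinates suffice. Of the five spanning vectors,
  the last three and the difference of the first two preserve the form of \<open>u\<close> and
  \<open>v\<close> to first order; the sum of the first two scales it.\<close>

lemma orthogonal_row_gradients_subset:
  fixes k l :: "'m::finite"
  assumes kl: "k \<noteq> l"
    and orth: "\<And>a. a $ k \<bullet> a $ l = 0 \<Longrightarrow> row_gradient k l a \<bullet> (p, q) = 0"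
  shows "(p, q) \<in> span {(axis k 1, 0), (0, axis l 1), (axis l \<i>, 0), (0, axis k \<i>),
      (axis k \<i>, axis l \<i>)}"
    (is "_ \<in> span ?B")
proof -
  have one: "(\<Sum>j\<in>UNIV. axis i x $ j * r $ j) = x * r $ i" for i x and r :: "complex ^ 'm"
    by (simp add: axis_def if_distrib if_distribR cong: if_cong)
  have two: "(\<Sum>j\<in>UNIV. (axis i x + axis i' y) $ j * r $ j) = x * r $ i + y * r $ i'"
    for i i' x y and r :: "complex ^ 'm"
    by (simp only: vector_add_component distrib_right sum.distrib one)
  have orth2: "(x * p $ i + y * p $ i') \<bullet> a $ l + a $ k \<bullet> (x * q $ i + y * q $ i') = 0"
    if "a = axis i x + axis i' y" "a $ k \<bullet> a $ l = 0" for a i i' x y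
    using orth[OF that(2)] unfolding that(1) row_gradient_inner two by simp
  have k: "Re (q $ k) = 0"
    using orth2[of _ k 1 k 0, OF refl] kl by (simp add: axis_def inner_complex_def)
  have l: "Re (p $ l) = 0"
    using orth2[of _ l 1 l 0, OF refl] kl by (simp add: axis_def inner_complex_def)
  \<comment> \<open>The entries 1 and \<open>\<i>\<close> are orthogonal over the reals, so this row
    is admissible although both its \<open>k\<close> and \<open>l\<close> entries are
    nonzero.\<close>
  have kl': "Im (q $ l) = Im (p $ k)"
    using orth2[of _ k 1 l \<i>, OF refl] kl k l by (simp add: axis_def inner_complex_def)
  \<comment> \<open>The \<open>l\<close> entry of these rows is 0, so \<open>p\<close> drops out;
    the coefficients 1 and \<open>\<i>\<close> at \<open>j\<close> isolate the real and the
    imaginary part of \<open>q $ j\<close>.\<close>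
  have q: "q $ j = 0" if "j \<noteq> k" "j \<noteq> l" for j
    using orth2[of _ k 1 j 1, OF refl] orth2[of _ k 1 j \<i>, OF refl] that kl k
    by (simp add: axis_def inner_complex_def complex_eq_iff)
  have p: "p $ j = 0" if "j \<noteq> k" "j \<noteq> l" for j
    using orth2[of _ l 1 j 1, OF refl] orth2[of _ l 1 j \<i>, OF refl] that kl l
    by (simp add: axis_def inner_complex_def complex_eq_iff)
  have "(p, q) = Re (p $ k) *\<^sub>R (axis k 1, 0) + Re (q $ l) *\<^sub>R (0, axis l 1) +
      Im (p $ l) *\<^sub>R (axis l \<i>, 0) + Im (q $ k) *\<^sub>R (0, axis k \<i>) +
      Im (p $ k) *\<^sub>R (axis k \<i>, axis l \<i>)"
    using k l kl kl' p q by (auto simp: vec_eq_iff axis_def complex_eq_iff)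
  also have "\<dots> \<in> span ?B"
    by (intro span_add span_scale span_base) simp_all
  finally show ?thesis .
qed

text \<open>The pairs \<open>(p, q)\<close> form a space of real dimension
  \<open>4 * CARD('m)\<close>, in which the orthogonal complement of the gradients has dimension at
  most 5.\<close>

lemma dim_row_gradients:
  fixes k l :: "'m::finite"
  assumes "k \<noteq> l"
  shows "4 * CARD('m) - 5 \<le> dim {row_gradient k l a |a. a $ k \<bullet> a $ l = 0}" (is "_ \<le> dim ?S")
proof -
  let ?B = "{(axis k 1, 0), (0, axis l 1), (axis l \<i>, 0), (0, axis k \<i>),
      (axis k \<i>, axis l \<i>)} :: ((complex ^ 'm) \<times> (complex ^ 'm)) set"
  let ?C = "{y \<in> UNIV. \<forall>x\<in>span ?S. orthogonal x y}"
  have "?C \<subseteq> span ?B"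
  proof clarsimp
    fix p q assume *: "\<forall>x\<in>span ?S. orthogonal x (p, q)"
    show "(p, q) \<in> span ?B"
      by (rule orthogonal_row_gradients_subset[OF assms])
        (use * in \<open>auto simp: orthogonal_def intro: span_base\<close>)
  qed
  then have "dim ?C \<le> card ?B"
    by (rule dim_le_card) simp
  also have "\<dots> \<le> 5"
    by (rule order_trans[OF card_insert_le_m1]) (auto intro!: card_insert_le_m1)
  finally have "dim ?C \<le> 5" .
  moreover have "dim ?C + dim (span ?S) = dim (UNIV :: ((complex ^ 'm) \<times> (complex ^ 'm)) set)"
    by (rule dim_subspace_orthogonal_to_vectors) auto
  ultimately show ?thesis
    by simp
qed

section \<open>Construction of the matrix\<close>

lemma exists_open_not_injective:
  assumes "CARD('m::finite) \<ge> 2"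
    and "CARD('n::finite) \<le> 4 * CARD('m) - 5"
  shows "\<exists>U :: (complex ^ 'm ^ 'n) set. open U \<and> U \<noteq> {} \<and>
            (\<forall>A\<in>U. \<not> injective_for_phase_retrieval A)"
proof -
  obtain k l :: 'm where kl: "k \<noteq> l"
    using assms(1) by (metis card_le_Suc0_iff_eq finite not_less_eq_eq numeral_2_eq_2)
  let ?S = "{row_gradient k l a |a. a $ k \<bullet> a $ l = 0}"
  \<comment> \<open>The basis is drawn from the gradients themselves, so each of its members comes
    from an admissible row, which can serve as a row of \<open>A\<close>.\<close>
  obtain B where B: "B \<subseteq> ?S" "independent B" "card B = dim ?S"
    by (rule basis_exists[of ?S])
  then have "CARD('n) \<le> card B"
    using dim_row_gradients[OF kl] assms(2) by linarith
  then obtain B' where B': "B' \<subseteq> B" "card B' = CARD('n)"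
    by (meson obtain_subset_with_card_n)
  then have "finite B'"
    by (metis card_gt_0_iff zero_less_card_finite)
  then obtain f where "bij_betw f (UNIV :: 'n set) B'"
    using finite_same_card_bij[of "UNIV :: 'n set" B'] B'(2) by auto
  then have f: "inj f" "range f = B'"
    by (auto simp: bij_betw_def)
  have "\<exists>a. f i = row_gradient k l a \<and> a $ k \<bullet> a $ l = 0" for i
    using f(2) B'(1) B(1) by blast
  then obtain a where a: "\<And>i. f i = row_gradient k l (a i)" "\<And>i. a i $ k \<bullet> a i $ l = 0"
    by metis
  define A :: "complex ^ 'm ^ 'n" where "A = (\<chi> i. a i)"
  have col: "(A *v axis j 1) $ i = a i $ j" for i j
    by (simp add: A_def matrix_vector_mult_def axis_def if_distrib if_distribR cong: if_cong)
  have "moment A (axis k 1) (axis l 1) = 0"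
    by (simp add: moment_def col a(2) vec_eq_iff)
  moreover have "\<exists>du dv. moment_deriv A (axis k 1) (axis l 1) (0, du, dv) = r" for r
  proof -
    have "independent (range f)"
      unfolding f(2) using independent_mono[OF B(2) B'(1)] .
    then obtain d where d: "\<And>i. f i \<bullet> d = r $ i"
      using independent_family_surj[OF f(1)] by metis
    obtain du dv where duv: "d = (du, dv)" by fastforce
    have "moment_deriv A (axis k 1) (axis l 1) (0, du, dv) $ i = f i \<bullet> (du, dv)" for i
      unfolding a(1) row_gradient_inner
      by (simp add: moment_deriv_def col) (simp add: A_def matrix_vector_mult_def)
    then show ?thesis
      using d duv by (metis vec_eq_iff)
  qed
  moreover have "\<not> phase_equiv (axis k 1 + axis l 1) (axis k 1 - axis l 1 :: complex ^ 'm)"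
  proof
    assume "phase_equiv (axis k 1 + axis l 1) (axis k 1 - axis l 1 :: complex ^ 'm)"
    then obtain z where z: "axis k 1 + axis l 1 = z *s (axis k 1 - axis l 1 :: complex ^ 'm)"
      by (auto simp: phase_equiv_def)
    from arg_cong[OF z, of "\<lambda>x. x $ k"] arg_cong[OF z, of "\<lambda>x. x $ l"] kl
    have "1 = z" "1 = - z" by (auto simp: axis_def)
    then show False by simp
  qed
  ultimately show ?thesis
    using open_not_injective_near[of A "axis k 1" "axis l 1"] by blast
qed

section \<open>Full support of the Gaussian law\<close>

text \<open>The density is strictly positive, so a null interval would also be null for Lebesgue
  measure.\<close>

lemma emeasure_normal_open_interval_pos:
  assumes "a < b" "0 < \<sigma>"
  shows "0 < emeasure (density lborel (normal_density \<mu> \<sigma>)) {a<..<b}"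
proof -
  have "{a<..<b} \<notin> null_sets (density lborel (normal_density \<mu> \<sigma>))"
  proof
    assume "{a<..<b} \<in> null_sets (density lborel (normal_density \<mu> \<sigma>))"
    then have "AE x in lborel. x \<in> {a<..<b} \<longrightarrow> ennreal (normal_density \<mu> \<sigma> x) = 0"
      by (subst (asm) null_sets_density_iff) auto
    then have "AE x in lborel. x \<notin> {a<..<b}"
      using normal_density_pos[OF assms(2)] by (auto simp: ennreal_eq_0_iff not_le elim!: eventually_mono dest: leD)
    then have "{a<..<b} \<in> null_sets lborel"
      by (subst AE_iff_null_sets) auto
    with assms(1) show False
      by (simp add: null_sets_def)
  qed
  then show ?thesis
    by (auto simp: null_sets_def zero_less_iff_neq_zero)
qed

lemma measurable_Complex: "(\<lambda>(a, b). Complex a b) \<in> borel \<Otimes>\<^sub>M borel \<rightarrow>\<^sub>M borel"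
proof -
  have "(\<lambda>(a, b). Complex a b) = (\<lambda>p. complex_of_real (fst p) + \<i> * complex_of_real (snd p))"
    by (auto simp: complex_eq_iff)
  also have "\<dots> \<in> borel \<Otimes>\<^sub>M borel \<rightarrow>\<^sub>M borel"
    by measurable
  finally show ?thesis .
qed

text \<open>An open set contains a box around \<open>z\<close>, whose measure factors into two
  normal measures of intervals.\<close>

lemma std_complex_gaussian_open_pos:
  assumes "open U" "z \<in> U"
  shows "0 < emeasure std_complex_gaussian U"
proof -
  let ?D = "density lborel (normal_density 0 (sqrt (1/2)))"
  interpret D: prob_space ?D
    by (rule prob_space_normal_density) simp
  from assms obtain a b where ab: "z \<in> box a b" "box a b \<subseteq> U"
    by (rule open_contains_box) 
  have "0 < emeasure ?D {Re a<..<Re b} * emeasure ?D {Im a<..<Im b}"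
    using ab(1) by (auto simp: ennreal_zero_less_mult_iff in_box_complex_iff
        intro!: emeasure_normal_open_interval_pos)
  also have "\<dots> = emeasure (?D \<Otimes>\<^sub>M ?D) ({Re a<..<Re b} \<times> {Im a<..<Im b})"
    by (rule D.emeasure_pair_measure_Times[symmetric]) auto
  also have "\<dots> \<le> emeasure (?D \<Otimes>\<^sub>M ?D) ((\<lambda>(a, b). Complex a b) -` U \<inter> space (?D \<Otimes>\<^sub>M ?D))"
  proof (rule emeasure_mono)
    show "{Re a<..<Re b} \<times> {Im a<..<Im b} \<subseteq> (\<lambda>(a, b). Complex a b) -` U \<inter> space (?D \<Otimes>\<^sub>M ?D)"
      using ab(2) by (auto simp: space_pair_measure in_box_complex_iff subset_iff)
    show "(\<lambda>(a, b). Complex a b) -` U \<inter> space (?D \<Otimes>\<^sub>M ?D) \<in> sets (?D \<Otimes>\<^sub>M ?D)"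
      using assms(1) measurable_Complex by measurable
  qed
  also have "\<dots> = emeasure std_complex_gaussian U"
    unfolding std_complex_gaussian_def
    by (rule emeasure_distr[symmetric]) (use assms(1) measurable_Complex in auto)
  finally show ?thesis .
qed

text \<open>\<open>U\<close> contains a product of open sets \<open>W i j\<close>, one for each
  entry; by independence its probability is a product of positive factors.\<close>

lemma gaussian_random_matrix_open_pos:
  fixes A :: "'w \<Rightarrow> complex ^ 'm ^ 'n" and U :: "(complex ^ 'm ^ 'n) set"
  assumes "gaussian_random_matrix P A" "open U" "U \<noteq> {}"
  shows "0 < measure P {\<omega> \<in> space P. A \<omega> \<in> U}"
proof -
  interpret prob_space P
    using assms(1) by (simp add: gaussian_random_matrix_def)
  note [measurable] = gaussian_random_matrix_measurable[OF assms(1)]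
  from assms(3) obtain B where "B \<in> U" by blast
  with assms(2) obtain V where V: "\<And>i. open (V i)" "\<And>i. B $ i \<in> V i"
      "\<And>C. (\<And>i. C $ i \<in> V i) \<Longrightarrow> C \<in> U"
    unfolding open_vec_def by metis
  \<comment> \<open>Matrices are vectors of rows, so the product topology is unfolded a second time,
    now inside each row.\<close>
  have "\<exists>W. (\<forall>j. open (W j) \<and> B $ i $ j \<in> W j) \<and> (\<forall>c. (\<forall>j. c $ j \<in> W j) \<longrightarrow> c \<in> V i)" for i
    using V(1,2)[of i] unfolding open_vec_def by metis
  then obtain W where W: "\<And>i j. open (W i j)" "\<And>i j. B $ i $ j \<in> W i j"
      "\<And>i c. (\<And>j. c $ j \<in> W i j) \<Longrightarrow> c \<in> V i"
    by metis
  let ?X = "\<lambda>(i, j) \<omega>. A \<omega> $ i $ j" and ?W = "\<lambda>(i, j). W i j"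
  have ind: "indep_vars (\<lambda>_. borel) ?X UNIV"
    and law: "\<And>i j. distr P borel (\<lambda>\<omega>. A \<omega> $ i $ j) = std_complex_gaussian"
    using assms(1) by (auto simp: gaussian_random_matrix_def)
  have meas: "?X t \<in> borel_measurable P" for t
    using ind unfolding indep_vars_def by blast
  have "0 < prob (?X t -` ?W t \<inter> space P)" for t
  proof -
    obtain i j where t: "t = (i, j)" by fastforce
    have "0 < emeasure (distr P borel (\<lambda>\<omega>. A \<omega> $ i $ j)) (W i j)"
      unfolding law using W(1,2) by (rule std_complex_gaussian_open_pos)
    also have "\<dots> = emeasure P (?X t -` ?W t \<inter> space P)"
      using W(1) meas[of t] by (simp add: t emeasure_distr)
    finally show ?thesis
      by (simp add: emeasure_eq_measure)
  qed
  then have "0 < (\<Prod>t\<in>UNIV. prob (?X t -` ?W t \<inter> space P))"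
    by (simp add: prod_pos)
  also have "\<dots> = prob (\<Inter>t\<in>UNIV. ?X t -` ?W t \<inter> space P)"
    by (rule indep_varsD_finite[OF ind, symmetric]) (use W(1) in auto)
  also have "\<dots> \<le> prob {\<omega> \<in> space P. A \<omega> \<in> U}"
  proof (rule finite_measure_mono)
    show "(\<Inter>t\<in>UNIV. ?X t -` ?W t \<inter> space P) \<subseteq> {\<omega> \<in> space P. A \<omega> \<in> U}"
      by (auto intro!: V(3) W(3))
    show "{\<omega> \<in> space P. A \<omega> \<in> U} \<in> events"
      using borel_open[OF assms(2)] by measurable
  qed
  finally show ?thesis .
qed

lemma injectivity_probability_less_1:
  fixes A :: "'w \<Rightarrow> complex ^ 'm ^ 'n" and U :: "(complex ^ 'm ^ 'n) set"
  assumes "gaussian_random_matrix P A" "open U" "U \<noteq> {}"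
    and "\<And>B. B \<in> U \<Longrightarrow> \<not> injective_for_phase_retrieval B"
  shows "injectivity_probability P A < 1"
proof -
  interpret prob_space P
    using assms(1) by (simp add: gaussian_random_matrix_def)
  note [measurable] = gaussian_random_matrix_measurable[OF assms(1)]
  have U: "{\<omega> \<in> space P. A \<omega> \<in> U} \<in> events"
    using borel_open[OF assms(2)] by measurable
  have "injectivity_probability P A \<le> prob (space P - {\<omega> \<in> space P. A \<omega> \<in> U})"
    unfolding injectivity_probability_def
    by (rule finite_measure_mono) (use assms(4) U in auto)
  also have "\<dots> = 1 - prob {\<omega> \<in> space P. A \<omega> \<in> U}"
    using U by (rule prob_compl)
  also have "\<dots> < 1"
    using gaussian_random_matrix_open_pos[OF assms(1-3)] by simp
  finally show ?thesis .
qed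

theorem theorem1p2:
  assumes "CARD('m::finite) \<ge> 2"
    and "CARD('n::finite) = 4 * CARD('m) - 5"
  shows "(\<exists>U :: (complex ^ 'm ^ 'n) set. open U \<and> U \<noteq> {} \<and>
            (\<forall>A\<in>U. \<not> injective_for_phase_retrieval A)) \<and>
         (\<forall>(P :: 'w measure) (A :: 'w \<Rightarrow> complex ^ 'm ^ 'n).
            gaussian_random_matrix P A \<longrightarrow> injectivity_probability P A < 1)"
proof -
  obtain U :: "(complex ^ 'm ^ 'n) set" where U: "open U" "U \<noteq> {}"
      "\<And>A. A \<in> U \<Longrightarrow> \<not> injective_for_phase_retrieval A"
    using exists_open_not_injective[where 'm = 'm and 'n = 'n] assms by auto
  moreover from U have "injectivity_probability P A < 1" if "gaussian_random_matrix P A"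
    for P :: "'w measure" and A :: "'w \<Rightarrow> complex ^ 'm ^ 'n"
    using injectivity_probability_less_1[OF that] by blast
  ultimately show ?thesis
    by blast
qed

end
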